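(* Let $\gamma:\mathbb{S}^1\to\mathbb{R}^2$ be an $\ell$-convex Legendre curve with algebraic length $L$ and algebraic area $A$. Then $$L^2-4\pi A\ge 0,$$ with equality if and only if $\gamma$ is a circle.
   Context: $\mathbb{S}^1=\mathbb{R}/2\pi\mathbb{Z}$; all maps are smooth. A closed Legendre curve is a smooth map $\gamma:\mathbb{S}^1\to\mathbb{R}^2$ with a smooth unit vector field $\nu$ along it satisfying $\langle\gamma',\nu\rangle=0$; with $\mu=J\nu$ ($J$ = counterclockwise rotation by $\pi/2$), put $\ell=\langle\nu',\mu\rangle$ and $\gamma'=\beta\mu$. It is $\ell$-convex if $\ell>0$. Convention: such curves are parametrized so that $\ell\equiv1$, $\nu(\theta)=(\cos\theta,\sin\theta)$; then $\gamma(\theta)=p(\theta)(\cos\theta,\sin\theta)+p'(\theta)(-\sin\theta,\cos\theta)$ for a smooth $2\pi$-periodic support function $p$, and $\beta=p+p''$. The algebraic length and area are $L=\int_0^{2\pi}p\,d\theta=\int_0^{2\pi}\beta\,d\theta$ and $A=\frac12\int_0^{2\pi}p(p+p'')\,d\theta$. A circle is a curve with $p(\theta)=a_0+a_1\cos\theta+b_1\sin\theta$ (radius $|a_0|$; a point is regarded as a circle of radius $0$). *)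

theory Defs
  imports "HOL-Analysis.Analysis"
begin

(* The circle R/2piZ is rendered by functions on the reals of period 2pi. *)

definition periodic_2pi :: "(real \<Rightarrow> 'a) \<Rightarrow> bool" where
  "periodic_2pi f \<longleftrightarrow> (\<forall>t. f (t + 2 * pi) = f t)"

(* Smooth = derivatives of all orders exist; D k is the k-th derivative of f. *)

definition smooth_map :: "(real \<Rightarrow> 'a::real_normed_vector) \<Rightarrow> bool" where
  "smooth_map f \<longleftrightarrow>
     (\<exists>D. D 0 = f \<and> (\<forall>k t. (D k has_vector_derivative D (Suc k) t) (at t)))"

definition J :: "real ^ 2 \<Rightarrow> real ^ 2" where
  "J v = vector [- v $ 2, v $ 1]"

definition closed_legendre_curve ::
  "(real \<Rightarrow> real ^ 2) \<Rightarrow> (real \<Rightarrow> real ^ 2) \<Rightarrow> bool" where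
  "closed_legendre_curve \<gamma> \<nu> \<longleftrightarrow>
     smooth_map \<gamma> \<and> periodic_2pi \<gamma> \<and> smooth_map \<nu> \<and> periodic_2pi \<nu> \<and>
     (\<forall>t. norm (\<nu> t) = 1) \<and> (\<forall>t. vector_derivative \<gamma> (at t) \<bullet> \<nu> t = 0)"

definition legendre_mu :: "(real \<Rightarrow> real ^ 2) \<Rightarrow> real \<Rightarrow> real ^ 2" where
  "legendre_mu \<nu> t = J (\<nu> t)"

definition legendre_ell :: "(real \<Rightarrow> real ^ 2) \<Rightarrow> real \<Rightarrow> real" where
  "legendre_ell \<nu> t = vector_derivative \<nu> (at t) \<bullet> legendre_mu \<nu> t"

(* Since mu is a unit vector and the velocity is orthogonal to nu, this is the
   coefficient in velocity = beta * mu; see legendre_velocity. *)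

definition legendre_beta ::
  "(real \<Rightarrow> real ^ 2) \<Rightarrow> (real \<Rightarrow> real ^ 2) \<Rightarrow> real \<Rightarrow> real" where
  "legendre_beta \<gamma> \<nu> t = vector_derivative \<gamma> (at t) \<bullet> legendre_mu \<nu> t"

definition ell_convex_legendre_curve ::
  "(real \<Rightarrow> real ^ 2) \<Rightarrow> (real \<Rightarrow> real ^ 2) \<Rightarrow> bool" where
  "ell_convex_legendre_curve \<gamma> \<nu> \<longleftrightarrow>
     closed_legendre_curve \<gamma> \<nu> \<and> (\<forall>t. legendre_ell \<nu> t > 0)"

definition normal_angle_parametrized :: "(real \<Rightarrow> real ^ 2) \<Rightarrow> bool" where
  "normal_angle_parametrized \<nu> \<longleftrightarrow>
     (\<forall>\<theta>. legendre_ell \<nu> \<theta> = 1) \<and> (\<forall>\<theta>. \<nu> \<theta> = vector [cos \<theta>, sin \<theta>])"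

(* The notions below are meant for curves parametrized by the normal angle.  For
   these, pairing gamma = p * nu + p' * mu with nu shows that p has to be the
   function defined here; conversely see support_function_representation. *)

definition support_function ::
  "(real \<Rightarrow> real ^ 2) \<Rightarrow> (real \<Rightarrow> real ^ 2) \<Rightarrow> real \<Rightarrow> real" where
  "support_function \<gamma> \<nu> \<theta> = \<gamma> \<theta> \<bullet> \<nu> \<theta>"

definition algebraic_length ::
  "(real \<Rightarrow> real ^ 2) \<Rightarrow> (real \<Rightarrow> real ^ 2) \<Rightarrow> real" where
  "algebraic_length \<gamma> \<nu> = integral {0..2 * pi} (support_function \<gamma> \<nu>)"

definition algebraic_area ::
  "(real \<Rightarrow> real ^ 2) \<Rightarrow> (real \<Rightarrow> real ^ 2) \<Rightarrow> real" where
  "algebraic_area \<gamma> \<nu> =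
     (let p = support_function \<gamma> \<nu>
      in 1 / 2 * integral {0..2 * pi} (\<lambda>\<theta>. p \<theta> * (p \<theta> + deriv (deriv p) \<theta>)))"

(* The radius is the absolute value of a0; points (a0 = 0) are included. *)

definition is_circle :: "(real \<Rightarrow> real ^ 2) \<Rightarrow> (real \<Rightarrow> real ^ 2) \<Rightarrow> bool" where
  "is_circle \<gamma> \<nu> \<longleftrightarrow>
     (\<exists>a0 a1 b1. \<forall>\<theta>. support_function \<gamma> \<nu> \<theta> = a0 + a1 * cos \<theta> + b1 * sin \<theta>)"

lemma smooth_map_has_vector_derivative:
  assumes "smooth_map f"
  shows "(f has_vector_derivative vector_derivative f (at t)) (at t)"
    and "smooth_map (\<lambda>t. vector_derivative f (at t))"
proof -
  obtain D where D: "D 0 = f" "\<And>k t. (D k has_vector_derivative D (Suc k) t) (at t)"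
    using assms unfolding smooth_map_def by blast
  have eq: "vector_derivative f (at t) = D (Suc 0) t" for t
    using D(2)[of 0 t] D(1) by (simp add: vector_derivative_at)
  show "(f has_vector_derivative vector_derivative f (at t)) (at t)"
    using D(2)[of 0 t] D(1) eq by simp
  show "smooth_map (\<lambda>t. vector_derivative f (at t))"
    unfolding smooth_map_def using D(2) eq
    by (intro exI[of _ "\<lambda>k. D (Suc k)"]) (simp add: fun_eq_iff)
qed

lemma legendre_velocity:
  assumes "closed_legendre_curve \<gamma> \<nu>"
  shows "vector_derivative \<gamma> (at t) = legendre_beta \<gamma> \<nu> t *\<^sub>R legendre_mu \<nu> t"
proof -
  define v where "v = vector_derivative \<gamma> (at t)"
  have orth: "v $ 1 * \<nu> t $ 1 + v $ 2 * \<nu> t $ 2 = 0"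
    using assms by (simp add: closed_legendre_curve_def v_def inner_vec_def sum_2)
  have "\<nu> t \<bullet> \<nu> t = 1"
    using assms by (simp add: closed_legendre_curve_def norm_eq_1)
  then have unit: "\<nu> t $ 1 * \<nu> t $ 1 + \<nu> t $ 2 * \<nu> t $ 2 = 1"
    by (simp add: inner_vec_def sum_2)
  have "v $ 1 = (v $ 2 * \<nu> t $ 1 - v $ 1 * \<nu> t $ 2) * (- \<nu> t $ 2)"
    using orth unit by algebra
  moreover have "v $ 2 = (v $ 2 * \<nu> t $ 1 - v $ 1 * \<nu> t $ 2) * \<nu> t $ 1"
    using orth unit by algebra
  ultimately show ?thesis
    by (simp add: vec_eq_iff forall_2 legendre_beta_def legendre_mu_def J_def inner_vec_def
        sum_2 flip: v_def)
qed

lemma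
  assumes L: "closed_legendre_curve \<gamma> \<nu>" and N: "normal_angle_parametrized \<nu>"
  defines "p \<equiv> support_function \<gamma> \<nu>"
  shows support_function_deriv:
      "(p has_real_derivative \<gamma> \<theta> \<bullet> legendre_mu \<nu> \<theta>) (at \<theta>)"
    and support_function_deriv2:
      "(deriv p has_real_derivative legendre_beta \<gamma> \<nu> \<theta> - p \<theta>) (at \<theta>)"
    and support_function_representation:
      "\<gamma> \<theta> = p \<theta> *\<^sub>R vector [cos \<theta>, sin \<theta>] + deriv p \<theta> *\<^sub>R vector [- sin \<theta>, cos \<theta>]"
    and legendre_beta_support_function:
      "legendre_beta \<gamma> \<nu> \<theta> = p \<theta> + deriv (deriv p) \<theta>"
proof -
  have nu: "\<nu> t = vector [cos t, sin t]" for t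
    using N by (simp add: normal_angle_parametrized_def)
  have mu: "legendre_mu \<nu> t = vector [- sin t, cos t]" for t
    by (simp add: legendre_mu_def J_def nu)
  define g where "g = (\<lambda>t. vector_derivative \<gamma> (at t))"
  have g: "(\<gamma> has_vector_derivative g t) (at t)" for t
    using L smooth_map_has_vector_derivative(1)
    by (auto simp: closed_legendre_curve_def g_def)
  have gi: "((\<lambda>t. \<gamma> t $ i) has_real_derivative g t $ i) (at t)" for t i
    using bounded_linear.has_vector_derivative[OF bounded_linear_vec_nth g]
    by (simp add: has_real_derivative_iff_has_vector_derivative)
  have orth: "g t $ 1 * cos t + g t $ 2 * sin t = 0" for t
    using L by (simp add: closed_legendre_curve_def g_def nu inner_vec_def sum_2)
  have p: "p = (\<lambda>t. \<gamma> t $ 1 * cos t + \<gamma> t $ 2 * sin t)"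
    by (simp add: fun_eq_iff p_def support_function_def nu inner_vec_def sum_2)
  have gm: "\<gamma> t \<bullet> legendre_mu \<nu> t = \<gamma> t $ 2 * cos t - \<gamma> t $ 1 * sin t" for t
    by (simp add: mu inner_vec_def sum_2)
  have d1: "(p has_real_derivative \<gamma> t \<bullet> legendre_mu \<nu> t) (at t)" for t
    unfolding p gm using orth[of t]
    by (auto intro!: derivative_eq_intros gi simp: algebra_simps)
  then show "(p has_real_derivative \<gamma> \<theta> \<bullet> legendre_mu \<nu> \<theta>) (at \<theta>)" .
  have dp: "deriv p = (\<lambda>t. \<gamma> t $ 2 * cos t - \<gamma> t $ 1 * sin t)"
    using d1 by (auto simp: fun_eq_iff gm intro!: DERIV_imp_deriv)
  have beta: "legendre_beta \<gamma> \<nu> t = g t $ 2 * cos t - g t $ 1 * sin t" for t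
    by (simp add: legendre_beta_def g_def mu inner_vec_def sum_2)
  show d2: "(deriv p has_real_derivative legendre_beta \<gamma> \<nu> \<theta> - p \<theta>) (at \<theta>)"
    unfolding dp beta unfolding p
    by (auto intro!: derivative_eq_intros gi simp: algebra_simps)
  show "legendre_beta \<gamma> \<nu> \<theta> = p \<theta> + deriv (deriv p) \<theta>"
    using DERIV_imp_deriv[OF d2] by simp
  have sc: "sin \<theta> * sin \<theta> = 1 - cos \<theta> * cos \<theta>"
    using sin_cos_squared_add[of \<theta>] by (simp add: power2_eq_square)
  have "\<gamma> \<theta> $ 1 = p \<theta> * cos \<theta> - deriv p \<theta> * sin \<theta>"
    unfolding dp unfolding p using sc by algebra
  moreover have "\<gamma> \<theta> $ 2 = p \<theta> * sin \<theta> + deriv p \<theta> * cos \<theta>"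
    unfolding dp unfolding p using sc by algebra
  ultimately show "\<gamma> \<theta> = p \<theta> *\<^sub>R vector [cos \<theta>, sin \<theta>] + deriv p \<theta> *\<^sub>R vector [- sin \<theta>, cos \<theta>]"
    by (simp add: vec_eq_iff forall_2)
qed

lemma algebraic_length_eq_integral_beta:
  assumes L: "closed_legendre_curve \<gamma> \<nu>" and N: "normal_angle_parametrized \<nu>"
  shows "algebraic_length \<gamma> \<nu> = integral {0..2 * pi} (legendre_beta \<gamma> \<nu>)"
proof -
  define p where "p = support_function \<gamma> \<nu>"
  note [simp] = p_def[symmetric]
  have "deriv p t = \<gamma> t \<bullet> legendre_mu \<nu> t" for t
    using DERIV_imp_deriv[OF support_function_deriv[OF L N]] by simp
  moreover have "\<gamma> (0 + 2 * pi) = \<gamma> 0" "\<nu> (0 + 2 * pi) = \<nu> 0"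
    using L by (auto simp only: closed_legendre_curve_def periodic_2pi_def)
  ultimately have per: "deriv p (2 * pi) = deriv p 0"
    by (simp add: legendre_mu_def)
  have "((\<lambda>t. legendre_beta \<gamma> \<nu> t - p t) has_integral deriv p (2 * pi) - deriv p 0) {0..2 * pi}"
    using support_function_deriv2[OF L N]
    by (intro fundamental_theorem_of_calculus)
      (auto simp: has_real_derivative_iff_has_vector_derivative[symmetric]
        intro: has_field_derivative_at_within)
  then have "((\<lambda>t. legendre_beta \<gamma> \<nu> t - p t) has_integral 0) {0..2 * pi}"
    using per by simp
  moreover have "continuous_on {0..2 * pi} p"
    using support_function_deriv[OF L N]
    by (intro continuous_at_imp_continuous_on ballI) (auto intro: DERIV_isCont)
  then have "(p has_integral integral {0..2 * pi} p) {0..2 * pi}"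
    by (intro integrable_integral integrable_continuous_real)
  ultimately have "((\<lambda>t. (legendre_beta \<gamma> \<nu> t - p t) + p t) has_integral
      0 + integral {0..2 * pi} p) {0..2 * pi}"
    by (rule has_integral_add)
  then show ?thesis
    by (simp add: algebraic_length_def integral_unique)
qed

end

theory Submission
  imports Defs "HOL-Library.Periodic_Fun"
begin

text \<open>
  By the intermediate value theorem there is an \<open>a\<close> with \<open>p (a + \<pi>) = p a\<close>. For
  \<open>q = p - p a\<close>, integration by parts turns \<open>L\<^sup>2 - 4 \<pi> A\<close> into
  \<open>(\<integral> q)\<^sup>2 + 2 \<pi> \<integral> (q'\<^sup>2 - q\<^sup>2)\<close>. Both summands are nonnegative, since
  \<open>q'\<^sup>2 - q\<^sup>2 = (q' - q cot (t - a))\<^sup>2 + (q\<^sup>2 cot (t - a))'\<close>, where the singularities of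
  the cotangent are cancelled by the zeros of \<open>q\<^sup>2\<close>. If the sum vanishes, then
  \<open>q' sin (t - a) = q cos (t - a)\<close>, so that \<open>q\<close> is a multiple of \<open>sin (t - a)\<close>.
\<close>

section \<open>Periodic functions and the zeros of the sine\<close>

lemma periodic_2pi_add_int:
  assumes "periodic_2pi f"
  shows "f (x + of_int k * (2 * pi)) = f x"
proof -
  interpret periodic_fun_simple f "2 * pi"
    by standard (use assms in \<open>simp add: periodic_2pi_def\<close>)
  show ?thesis by (rule plus_of_int)
qed

text \<open>Subtracting the multiple of \<open>2 * pi\<close> given by the floor of
  \<open>x / (2 * pi)\<close> moves any point into the base interval.\<close>

lemma periodic_2pi_eqI:
  assumes "periodic_2pi f" "periodic_2pi g"
    and eq: "\<And>x. x \<in> {0..2 * pi} \<Longrightarrow> f x = g x"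
  shows "f x = g x"
proof -
  define k where "k = \<lfloor>x / (2 * pi)\<rfloor>"
  have "of_int k \<le> x / (2 * pi)" "x / (2 * pi) \<le> of_int k + 1"
    unfolding k_def by linarith+
  then have "of_int k * (2 * pi) \<le> x" "x \<le> (of_int k + 1) * (2 * pi)"
    by (simp_all add: pos_le_divide_eq pos_divide_le_eq)
  then have "x + of_int (- k) * (2 * pi) \<in> {0..2 * pi}"
    by (simp add: algebra_simps)
  then have "f (x + of_int (- k) * (2 * pi)) = g (x + of_int (- k) * (2 * pi))"
    by (rule eq)
  then show ?thesis
    by (simp only: periodic_2pi_add_int assms)
qed

text \<open>The difference \<open>f (x + pi) - f x\<close> changes sign under a shift by
  \<open>pi\<close>, so it takes opposite values at \<open>0\<close> and \<open>pi\<close> and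
  vanishes in between.\<close>

lemma periodic_2pi_antipodal_values_eq:
  fixes f :: "real \<Rightarrow> real"
  assumes per: "periodic_2pi f" and cont: "continuous_on UNIV f"
  obtains a where "f (a + pi) = f a"
proof -
  define d where "d x = f (x + pi) - f x" for x
  have cd: "continuous_on {0..pi} d"
    unfolding d_def
    by (intro continuous_intros continuous_on_compose2[OF cont]) auto
  have dpi: "d pi = - d 0"
    using per[unfolded periodic_2pi_def, rule_format, of 0] by (simp add: d_def)
  have "\<exists>x. 0 \<le> x \<and> x \<le> pi \<and> d x = 0"
  proof (cases "d 0 \<le> 0")
    case True
    then show ?thesis using IVT'[of d 0 0 pi] cd dpi by auto
  next
    case False
    then show ?thesis using IVT2'[of d pi 0 0] cd dpi by auto
  qed
  then show ?thesis using that by (auto simp: d_def)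
qed

text \<open>Provides the finite exceptional set, the poles of \<open>cot (x - a)\<close>, for the
  fundamental theorem of calculus and for the criterion for constancy used below.\<close>

lemma finite_sin_zeros:
  fixes a b c :: real
  shows "finite {x \<in> {b..c}. sin (x - a) = 0}"
proof (rule finite_subset)
  show "{x \<in> {b..c}. sin (x - a) = 0}
      \<subseteq> (\<lambda>k. a + of_int k * pi) ` {\<lceil>(b - a) / pi\<rceil>..\<lfloor>(c - a) / pi\<rfloor>}"
  proof safe
    fix x assume x: "x \<in> {b..c}" "sin (x - a) = 0"
    then obtain k :: int where k: "x - a = of_int k * pi"
      using sin_zero_iff_int2 by blast
    have "k \<in> {\<lceil>(b - a) / pi\<rceil>..\<lfloor>(c - a) / pi\<rfloor>}"
      using x(1) by (simp add: ceiling_le_iff le_floor_iff pos_divide_le_eq pos_le_divide_eq k[symmetric])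
    then show "x \<in> (\<lambda>k. a + of_int k * pi) ` {\<lceil>(b - a) / pi\<rceil>..\<lfloor>(c - a) / pi\<rfloor>}"
      using k by (intro image_eqI[of _ _ k]) auto
  qed
qed simp

text \<open>The zeros of \<open>sin (x - a)\<close> are the points \<open>a + k * pi\<close>; by
  periodicity, the parity of \<open>k\<close> reduces them to \<open>a\<close> or
  \<open>a + pi\<close>.\<close>

lemma periodic_2pi_zero_at_sin_zero:
  fixes q :: "real \<Rightarrow> real"
  assumes per: "periodic_2pi q" and "q a = 0" "q (a + pi) = 0" and "sin (z - a) = 0"
  shows "q z = 0"
proof -
  obtain k :: int where k: "z - a = of_int k * pi"
    using assms(4) sin_zero_iff_int2 by blast
  show ?thesis
  proof (cases "even k")
    case True
    then obtain m where "k = 2 * m" by blast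
    then have "z = a + of_int m * (2 * pi)" using k by simp
    then show ?thesis using periodic_2pi_add_int[OF per] assms(2) by simp
  next
    case False
    then obtain m where "k = 2 * m + 1" by (elim oddE)
    then have "z = (a + pi) + of_int m * (2 * pi)" using k by (simp add: algebra_simps)
    then show ?thesis using periodic_2pi_add_int[OF per] assms(3) by simp
  qed
qed

section \<open>Wirtinger's inequality for functions with two antipodal zeros\<close>

context
  fixes q q' :: "real \<Rightarrow> real" and a :: real
  assumes per: "periodic_2pi q"
    and der: "\<And>x. (q has_real_derivative q' x) (at x)"
    and zeros: "q a = 0" "q (a + pi) = 0"
begin

text \<open>At a pole \<open>z\<close> of the cotangent \<open>q\<close> vanishes too. Comparing
  difference quotients, \<open>q x / sin (x - a)\<close> tends to \<open>q' z / cos (z - a)\<close>,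
  and the remaining factor \<open>q x * cos (x - a)\<close> tends to \<open>0\<close>. This is also
  the value at \<open>z\<close>, because \<open>q z = 0\<close>.\<close>

lemma isCont_square_mult_cot: "isCont (\<lambda>x. (q x)\<^sup>2 * cot (x - a)) z"
proof (cases "sin (z - a) = 0")
  case False
  then show ?thesis
    using der[of z, THEN DERIV_isCont] by (intro continuous_intros) auto
next
  case True
  have qz: "q z = 0"
    using periodic_2pi_zero_at_sin_zero[OF per zeros True] .
  have cz: "cos (z - a) \<noteq> 0"
    using True sin_zero_abs_cos_one by fastforce
  have "((\<lambda>x. q x / (x - z)) \<longlongrightarrow> q' z) (at z)"
    using der[of z] by (simp add: has_field_derivative_iff qz)
  moreover have "((\<lambda>x. sin (x - a)) has_real_derivative cos (z - a)) (at z)"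
    by (auto intro!: derivative_eq_intros)
  then have "((\<lambda>x. sin (x - a) / (x - z)) \<longlongrightarrow> cos (z - a)) (at z)"
    by (simp add: has_field_derivative_iff True)
  ultimately have "((\<lambda>x. (q x / (x - z)) / (sin (x - a) / (x - z))) \<longlongrightarrow> q' z / cos (z - a)) (at z)"
    using cz by (rule tendsto_divide)
  moreover have "\<forall>\<^sub>F x in at z. (q x / (x - z)) / (sin (x - a) / (x - z)) = q x / sin (x - a)"
    by (auto simp: eventually_at_filter)
  ultimately have "((\<lambda>x. q x / sin (x - a)) \<longlongrightarrow> q' z / cos (z - a)) (at z)"
    by (rule Lim_transform_eventually)
  moreover have "isCont (\<lambda>x. q x * cos (x - a)) z"
    using der[of z, THEN DERIV_isCont] by (intro continuous_intros)
  then have "((\<lambda>x. q x * cos (x - a)) \<longlongrightarrow> 0) (at z)"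
    by (simp add: isCont_def qz)
  ultimately have "((\<lambda>x. (q x / sin (x - a)) * (q x * cos (x - a))) \<longlongrightarrow> q' z / cos (z - a) * 0) (at z)"
    by (rule tendsto_mult)
  then show ?thesis
    by (simp add: isCont_def qz cot_def power2_eq_square mult_ac)
qed

text \<open>The function \<open>?g\<close> is the derivative of the continuous \<open>?G\<close> off
  the poles, and \<open>?G\<close> agrees at both ends of the period, so \<open>?g\<close> has
  integral \<open>0\<close>. Integrability of the square comes along, as the square is a continuous
  function minus \<open>?g\<close>.\<close>

lemma wirtinger_has_integral:
  assumes cont: "continuous_on UNIV q'"
  shows "((\<lambda>x. (q' x - q x * cot (x - a))\<^sup>2) has_integral
    integral {0..2 * pi} (\<lambda>x. (q' x)\<^sup>2 - (q x)\<^sup>2)) {0..2 * pi}"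
proof -
  let ?G = "\<lambda>x. (q x)\<^sup>2 * cot (x - a)"
  let ?g = "\<lambda>x. ((q' x)\<^sup>2 - (q x)\<^sup>2) - (q' x - q x * cot (x - a))\<^sup>2"
  have cot_per: "cot (2 * pi - a) = cot (- a)"
    using cot_periodic[of "- a"] by (simp add: add.commute)
  have "(?g has_integral ?G (2 * pi) - ?G 0) {0..2 * pi}"
  proof (rule fundamental_theorem_of_calculus_interior_strong)
    show "finite {x \<in> {0..2 * pi}. sin (x - a) = 0}"
      by (rule finite_sin_zeros)
    show "continuous_on {0..2 * pi} ?G"
      by (intro continuous_at_imp_continuous_on ballI isCont_square_mult_cot)
    fix x assume "x \<in> {0<..<2 * pi} - {x \<in> {0..2 * pi}. sin (x - a) = 0}"
    then have s: "sin (x - a) \<noteq> 0" by auto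
    then have "(?G has_real_derivative
        2 * q x * q' x * cot (x - a) + (q x)\<^sup>2 * - inverse ((sin (x - a))\<^sup>2)) (at x)"
      by (auto intro!: derivative_eq_intros der DERIV_chain2[OF DERIV_cot])
    also have "inverse ((sin (x - a))\<^sup>2) = 1 + (cot (x - a))\<^sup>2"
      using s by (simp add: cot_def field_simps)
    also have "2 * q x * q' x * cot (x - a) + (q x)\<^sup>2 * - (1 + (cot (x - a))\<^sup>2) = ?g x"
      by (simp add: power2_eq_square algebra_simps)
    finally show "(?G has_vector_derivative ?g x) (at x)"
      by (simp add: has_real_derivative_iff_has_vector_derivative)
  qed simp
  moreover have "q (2 * pi) = q 0"
    using per[unfolded periodic_2pi_def, rule_format, of 0] by simp
  ultimately have g0: "(?g has_integral 0) {0..2 * pi}"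
    using cot_per by simp
  have "(\<lambda>x. (q' x)\<^sup>2 - (q x)\<^sup>2) integrable_on {0..2 * pi}"
    using der[THEN DERIV_isCont] cont
    by (intro integrable_continuous_real continuous_intros continuous_at_imp_continuous_on)
      (auto intro: continuous_on_subset simp: continuous_on_eq_continuous_at)
  then have "((\<lambda>x. ((q' x)\<^sup>2 - (q x)\<^sup>2) - ?g x) has_integral
      integral {0..2 * pi} (\<lambda>x. (q' x)\<^sup>2 - (q x)\<^sup>2) - 0) {0..2 * pi}"
    by (intro has_integral_diff integrable_integral g0)
  then show ?thesis by simp
qed

lemma wirtinger_antipodal:
  assumes "continuous_on UNIV q'"
  shows "integral {0..2 * pi} (\<lambda>x. (q' x)\<^sup>2 - (q x)\<^sup>2) \<ge> 0"
  using has_integral_nonneg[OF wirtinger_has_integral[OF assms]] by simp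

lemma wirtinger_antipodal_eq:
  assumes der2: "\<And>x. (q' has_real_derivative q'' x) (at x)"
    and eq: "integral {0..2 * pi} (\<lambda>x. (q' x)\<^sup>2 - (q x)\<^sup>2) = 0"
  obtains b where "\<And>x. q x = b * sin (x - a)"
proof -
  \<comment> \<open>The pair \<open>B\<close>, \<open>h\<close> is \<open>q'\<close>,
    \<open>q\<close> in coordinates turned by the angle \<open>x - a\<close>, up to the sign of
    \<open>h\<close>. Both derivatives contain the factor \<open>q'' + q\<close>, so
    \<open>h = 0\<close> will force \<open>B\<close> to be constant. Unlike the quotient of
    \<open>q\<close> by the sine, \<open>B\<close> stays defined at the zeros of the sine, so a
    single constant serves the whole period.\<close>
  define h where "h x = q' x * sin (x - a) - q x * cos (x - a)" for x
  define B where "B x = q' x * cos (x - a) + q x * sin (x - a)" for x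
  define S where "S = {x \<in> {0..2 * pi}. sin (x - a) = 0}"
  have cont: "continuous_on UNIV q'"
    by (simp add: continuous_at_imp_continuous_on DERIV_isCont[OF der2])
  have dh: "(h has_real_derivative (q'' x + q x) * sin (x - a)) (at x)" for x
    unfolding h_def by (auto intro!: derivative_eq_intros der der2 simp: algebra_simps)
  have dB: "(B has_real_derivative (q'' x + q x) * cos (x - a)) (at x)" for x
    unfolding B_def by (auto intro!: derivative_eq_intros der der2 simp: algebra_simps)
  have ch: "continuous_on {0..2 * pi} (\<lambda>x. (h x)\<^sup>2)"
    by (intro continuous_intros continuous_at_imp_continuous_on ballI DERIV_isCont[OF dh])
  \<comment> \<open>The right-hand side may jump at the zeros of the sine, whereas \<open>h\<close>
    is continuous. The bound thus turns a vanishing integral into \<open>h = 0\<close>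
    pointwise.\<close>
  have "(h x)\<^sup>2 \<le> (q' x - q x * cot (x - a))\<^sup>2" for x
  proof (cases "sin (x - a) = 0")
    case True
    then show ?thesis
      by (simp add: h_def periodic_2pi_zero_at_sin_zero[OF per zeros True])
  next
    case False
    then have "h x = (q' x - q x * cot (x - a)) * sin (x - a)"
      by (simp add: h_def cot_def left_diff_distrib)
    then show ?thesis
      using mult_left_le[of "(sin (x - a))\<^sup>2" "(q' x - q x * cot (x - a))\<^sup>2"]
      by (simp add: power_mult_distrib abs_square_le_1)
  qed
  then have "integral {0..2 * pi} (\<lambda>x. (h x)\<^sup>2) \<le> 0"
    using integral_le[OF integrable_continuous_real[OF ch]
        has_integral_integrable[OF wirtinger_has_integral[OF cont]]]
      integral_unique[OF wirtinger_has_integral[OF cont]] eq by simp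
  then have "integral {0..2 * pi} (\<lambda>x. (h x)\<^sup>2) = 0"
    by (intro antisym integral_nonneg integrable_continuous_real[OF ch]) auto
  then have h0: "h x = 0" if "x \<in> {0..2 * pi}" for x
    using integral_eq_0_iff[OF ch] that by simp
  have B0: "B x = B 0" if "x \<in> {0..2 * pi}" for x
  \<comment> \<open>The endpoints join the exceptional set because \<open>h\<close> is known to
    vanish only on the closed interval, which determines its two-sided derivative only in the
    interior.\<close>
  proof (rule has_derivative_zero_unique_strong_interval[of "S \<union> {0, 2 * pi}" 0 "2 * pi" B])
    show "finite (S \<union> {0, 2 * pi})"
      unfolding S_def using finite_sin_zeros by blast
    show "continuous_on {0..2 * pi} B"
      by (intro continuous_at_imp_continuous_on ballI DERIV_isCont[OF dB])
    fix y assume y: "y \<in> {0..2 * pi} - (S \<union> {0, 2 * pi})"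
    have "(h has_real_derivative 0) (at y)"
      by (rule has_field_derivative_transform_within_open[of "\<lambda>_. 0" _ _ "{0<..<2 * pi}"])
        (use y h0 in auto)
    with dh[of y] have "(q'' y + q y) * sin (y - a) = 0"
      by (rule DERIV_unique)
    then have "(q'' y + q y) * cos (y - a) = 0"
      using y by (auto simp: S_def)
    with dB[of y] have "(B has_real_derivative 0) (at y)"
      by simp
    then show "(B has_derivative (\<lambda>h. 0)) (at y within {0..2 * pi})"
      by (simp add: has_field_derivative_def lambda_zero has_derivative_at_withinI)
  qed (use that in auto)
  \<comment> \<open>Turning the coordinates back recovers \<open>q\<close>.\<close>
  have "B x * sin (x - a) - h x * cos (x - a)
      = q x * ((sin (x - a))\<^sup>2 + (cos (x - a))\<^sup>2)" for x
    unfolding B_def h_def power2_eq_square by (simp only: ring_distribs mult_ac)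
  then have "q x = B x * sin (x - a) - h x * cos (x - a)" for x
    by simp
  then have on: "q x = B 0 * sin (x - a)" if "x \<in> {0..2 * pi}" for x
    using B0[OF that] h0[OF that] by (metis diff_zero mult_zero_left)
  have "periodic_2pi (\<lambda>x. B 0 * sin (x - a))"
    using sin_periodic[of "t - a" for t] by (simp add: periodic_2pi_def algebra_simps)
  from per this on have "q x = B 0 * sin (x - a)" for x
    by (rule periodic_2pi_eqI)
  then show ?thesis by (rule that)
qed

end

section \<open>The isoperimetric deficit of a support function\<close>

context
  fixes p p' p'' :: "real \<Rightarrow> real"
  assumes per: "periodic_2pi p" "periodic_2pi p'"
    and der: "\<And>x. (p has_real_derivative p' x) (at x)"
    and der2: "\<And>x. (p' has_real_derivative p'' x) (at x)"
begin

text \<open>Integration by parts: the two integrands differ by the derivative of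
  \<open>p * p'\<close>, which integrates to \<open>0\<close> over a period.\<close>

lemma integral_support_area:
  "integral {0..2 * pi} (\<lambda>x. p x * (p x + p'' x)) = integral {0..2 * pi} (\<lambda>x. (p x)\<^sup>2 - (p' x)\<^sup>2)"
proof -
  have "((\<lambda>x. p x * p' x) has_real_derivative (p' x)\<^sup>2 + p x * p'' x) (at x)" for x
    by (auto intro!: derivative_eq_intros der der2 simp: power2_eq_square)
  then have "((\<lambda>x. (p' x)\<^sup>2 + p x * p'' x) has_integral
      p (2 * pi) * p' (2 * pi) - p 0 * p' 0) {0..2 * pi}"
    by (intro fundamental_theorem_of_calculus)
      (auto simp: has_real_derivative_iff_has_vector_derivative[symmetric]
        intro: has_field_derivative_at_within)
  moreover have "p (2 * pi) = p 0" "p' (2 * pi) = p' 0"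
    using per[unfolded periodic_2pi_def, THEN spec, of 0] by simp_all
  ultimately have "((\<lambda>x. (p' x)\<^sup>2 + p x * p'' x) has_integral 0) {0..2 * pi}"
    by simp
  moreover have "((\<lambda>x. (p x)\<^sup>2 - (p' x)\<^sup>2) has_integral
      integral {0..2 * pi} (\<lambda>x. (p x)\<^sup>2 - (p' x)\<^sup>2)) {0..2 * pi}"
    by (intro integrable_integral integrable_continuous_real continuous_intros
        continuous_at_imp_continuous_on ballI DERIV_isCont[OF der] DERIV_isCont[OF der2])
  ultimately have "((\<lambda>x. ((p' x)\<^sup>2 + p x * p'' x) + ((p x)\<^sup>2 - (p' x)\<^sup>2)) has_integral
      0 + integral {0..2 * pi} (\<lambda>x. (p x)\<^sup>2 - (p' x)\<^sup>2)) {0..2 * pi}"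
    by (rule has_integral_add)
  moreover have "((p' x)\<^sup>2 + p x * p'' x) + ((p x)\<^sup>2 - (p' x)\<^sup>2) = p x * (p x + p'' x)" for x
    by (simp add: power2_eq_square algebra_simps)
  ultimately show ?thesis by (simp add: integral_unique)
qed

text \<open>The left-hand side is invariant under \<open>p \<mapsto> p - c\<close>, that is, under passing to parallel curves.\<close>

lemma isoperimetric_deficit_shift:
  "(integral {0..2 * pi} p)\<^sup>2 - 2 * pi * integral {0..2 * pi} (\<lambda>x. (p x)\<^sup>2 - (p' x)\<^sup>2)
    = (integral {0..2 * pi} (\<lambda>x. p x - c))\<^sup>2
      + 2 * pi * integral {0..2 * pi} (\<lambda>x. (p' x)\<^sup>2 - (p x - c)\<^sup>2)"
proof -
  note conts = continuous_intros continuous_at_imp_continuous_on ballI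
    DERIV_isCont[OF der] DERIV_isCont[OF der2]
  define P where "P = integral {0..2 * pi} p"
  define E where "E = integral {0..2 * pi} (\<lambda>x. (p x)\<^sup>2 - (p' x)\<^sup>2)"
  have P: "(p has_integral P) {0..2 * pi}"
    unfolding P_def by (intro integrable_integral integrable_continuous_real conts)
  have E: "((\<lambda>x. (p x)\<^sup>2 - (p' x)\<^sup>2) has_integral E) {0..2 * pi}"
    unfolding E_def by (intro integrable_integral integrable_continuous_real conts)
  have const: "((\<lambda>x. k) has_integral 2 * pi * k) {0..2 * pi}" for k :: real
    using has_integral_const_real[of k 0 "2 * pi"] by simp
  have 1: "integral {0..2 * pi} (\<lambda>x. p x - c) = P - 2 * pi * c"
    by (intro integral_unique has_integral_diff P const)
  have "((\<lambda>x. (2 * c) * p x - ((p x)\<^sup>2 - (p' x)\<^sup>2) - c\<^sup>2) has_integral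
      (2 * c) * P - E - 2 * pi * c\<^sup>2) {0..2 * pi}"
    by (intro has_integral_diff has_integral_mult_right P E const)
  moreover have "(2 * c) * p x - ((p x)\<^sup>2 - (p' x)\<^sup>2) - c\<^sup>2 = (p' x)\<^sup>2 - (p x - c)\<^sup>2" for x
    by (simp add: power2_eq_square algebra_simps)
  ultimately have 2: "integral {0..2 * pi} (\<lambda>x. (p' x)\<^sup>2 - (p x - c)\<^sup>2) = (2 * c) * P - E - 2 * pi * c\<^sup>2"
    by (simp add: integral_unique)
  show ?thesis
    unfolding 1 2 P_def[symmetric] E_def[symmetric] by (simp add: power2_eq_square algebra_simps)
qed

lemma isoperimetric_support:
  defines "\<Delta> \<equiv> (integral {0..2 * pi} p)\<^sup>2 - 2 * pi * integral {0..2 * pi} (\<lambda>x. p x * (p x + p'' x))"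
  shows isoperimetric_support_nonneg: "\<Delta> \<ge> 0"
    and isoperimetric_support_eq:
      "\<Delta> = 0 \<longleftrightarrow> (\<exists>a0 a1 b1. \<forall>x. p x = a0 + a1 * cos x + b1 * sin x)"
proof -
  have contp: "continuous_on UNIV p" and contp': "continuous_on UNIV p'"
    by (simp_all add: continuous_at_imp_continuous_on DERIV_isCont[OF der] DERIV_isCont[OF der2])
  obtain a where a: "p (a + pi) = p a"
    using periodic_2pi_antipodal_values_eq[OF per(1) contp] .
  \<comment> \<open>The choice of \<open>a\<close> gives \<open>q\<close> the antipodal zeros
    \<open>a\<close> and \<open>a + pi\<close>, while its derivative is still
    \<open>p'\<close>.\<close>
  define q where "q x = p x - p a" for x
  define I where "I = integral {0..2 * pi} (\<lambda>x. (p' x)\<^sup>2 - (q x)\<^sup>2)"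
  have q: "periodic_2pi q" "\<And>x. (q has_real_derivative p' x) (at x)" "q a = 0" "q (a + pi) = 0"
    using per(1) a unfolding q_def
    by (auto simp: periodic_2pi_def intro!: derivative_eq_intros der)
  have D: "\<Delta> = (integral {0..2 * pi} q)\<^sup>2 + 2 * pi * I"
    unfolding \<Delta>_def integral_support_area isoperimetric_deficit_shift[of "p a"]
    by (simp add: q_def[abs_def] I_def)
  have I: "I \<ge> 0"
    unfolding I_def by (rule wirtinger_antipodal[OF q contp'])
  then show "\<Delta> \<ge> 0" by (simp add: D)
  show "\<Delta> = 0 \<longleftrightarrow> (\<exists>a0 a1 b1. \<forall>x. p x = a0 + a1 * cos x + b1 * sin x)"
  proof
    assume "\<Delta> = 0"
    then have "I = 0"
      using I D by (simp add: add_nonneg_eq_0_iff)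
    then obtain b where b: "\<And>x. q x = b * sin (x - a)"
      using wirtinger_antipodal_eq[OF q der2] unfolding I_def by blast
    have "p x = p a + (- b * sin a) * cos x + (b * cos a) * sin x" for x
      using b[of x] by (simp add: q_def sin_diff algebra_simps)
    then show "\<exists>a0 a1 b1. \<forall>x. p x = a0 + a1 * cos x + b1 * sin x" by blast
  next
    assume "\<exists>a0 a1 b1. \<forall>x. p x = a0 + a1 * cos x + b1 * sin x"
    then obtain a0 a1 b1 where "\<forall>x. p x = a0 + a1 * cos x + b1 * sin x" by blast
    then have p: "p = (\<lambda>x. a0 + a1 * cos x + b1 * sin x)" by auto
    have "p' = (\<lambda>x. b1 * cos x - a1 * sin x)"
      by (intro ext DERIV_unique[OF der]) (auto simp: p intro!: derivative_eq_intros)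
    moreover from this have "p'' = (\<lambda>x. - a1 * cos x - b1 * sin x)"
      by (intro ext DERIV_unique[OF der2]) (auto intro!: derivative_eq_intros)
    \<comment> \<open>The first harmonics cancel in \<open>p + p''\<close>, leaving the constant
      \<open>a0\<close>. With length \<open>2 * pi * a0\<close>, both terms of
      \<open>\<Delta>\<close> equal \<open>(2 * pi * a0)\<close> squared.\<close>
    ultimately have area: "integral {0..2 * pi} (\<lambda>x. p x * (p x + p'' x)) = integral {0..2 * pi} p * a0"
      by (simp add: p)
    let ?F = "\<lambda>x. a0 * x + a1 * sin x - b1 * cos x"
    have "(p has_integral ?F (2 * pi) - ?F 0) {0..2 * pi}"
      unfolding p
      by (intro fundamental_theorem_of_calculus)
        (auto simp: has_real_derivative_iff_has_vector_derivative[symmetric]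
          intro!: derivative_eq_intros)
    then have "integral {0..2 * pi} p = 2 * pi * a0"
      by (simp add: integral_unique)
    then show "\<Delta> = 0"
      by (simp add: \<Delta>_def area power2_eq_square)
  qed
qed

end

section \<open>Passage from the Legendre curve to its support function\<close>

theorem theorem5p1:
  fixes \<gamma> \<nu> :: "real \<Rightarrow> real ^ 2" and L A :: real
  assumes "ell_convex_legendre_curve \<gamma> \<nu>"
    and "normal_angle_parametrized \<nu>"
    and "L = algebraic_length \<gamma> \<nu>"
    and "A = algebraic_area \<gamma> \<nu>"
  shows "L\<^sup>2 - 4 * pi * A \<ge> 0 \<and>
         (L\<^sup>2 - 4 * pi * A = 0 \<longleftrightarrow> is_circle \<gamma> \<nu>)"
proof -
  define p where "p = support_function \<gamma> \<nu>"
  have C: "closed_legendre_curve \<gamma> \<nu>"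
    using assms(1) by (simp add: ell_convex_legendre_curve_def)
  note d1 = support_function_deriv[OF C assms(2), folded p_def]
  have dp: "deriv p = (\<lambda>x. \<gamma> x \<bullet> legendre_mu \<nu> x)"
    by (intro ext DERIV_imp_deriv d1)
  have der: "(p has_real_derivative deriv p x) (at x)" for x
    using d1 by (simp add: dp)
  have der2: "(deriv p has_real_derivative deriv (deriv p) x) (at x)" for x
    using support_function_deriv2[OF C assms(2), folded p_def] DERIV_imp_deriv by metis
  have per: "periodic_2pi p" "periodic_2pi (deriv p)"
    using C unfolding dp
    by (auto simp: p_def closed_legendre_curve_def periodic_2pi_def support_function_def
        legendre_mu_def)
  \<comment> \<open>The factor \<open>1 / 2\<close> in the area turns \<open>4 * pi\<close> into
    \<open>2 * pi\<close>.\<close>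
  have "L\<^sup>2 - 4 * pi * A
      = (integral {0..2 * pi} p)\<^sup>2 - 2 * pi * integral {0..2 * pi} (\<lambda>x. p x * (p x + deriv (deriv p) x))"
    by (simp add: assms(3,4) algebraic_length_def algebraic_area_def p_def Let_def)
  then show ?thesis
    using isoperimetric_support_nonneg[OF per der der2] isoperimetric_support_eq[OF per der der2]
    by (simp add: is_circle_def p_def)
qed

end
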